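(* Let $M = UV^{\mathsf T} \in \mathbb{R}^{6\times 6}$ where $$U = \frac{1}{2}\begin{bmatrix} 1 & 1 & 0\\ 1 & -1 & 0\\ 1 & 0 & 1\\ 1 & 0 & -1\\ 0 & 1 & 1\\ 0 & 1 & -1\end{bmatrix},\qquad V = \frac{1}{\sqrt{2}}\begin{bmatrix} 0 & 0 & 1\\ 0 & 0 & 1\\ 0 & 1 & 0\\ 0 & 1 & 0\\ 1 & 0 & 0\\ 1 & 0 & 0\end{bmatrix},$$ and let $\mathbf{\Delta} = \{\mathrm{diag}(\Delta_1,\ldots,\Delta_6) : \Delta_j \in \mathbb{C}\}$. Then $\nu_{\mathbf{\Delta}}(M) = \overline{\sigma}(M) = 1$, while $\mu_{\mathbf{\Delta}}(M) \ne \nu_{\mathbf{\Delta}}(M)$.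
   Context: For a matrix $A$, $\overline{\sigma}(A)$ denotes its largest singular value. Here $\mathbf{\Delta}$ is the set of complex diagonal $6\times 6$ matrices (six full complex blocks, each of size $1$). The structured singular value of $M \in \mathbb{C}^{6\times 6}$ with respect to $\mathbf{\Delta}$ is $$\mu_{\mathbf{\Delta}}(M) := \frac{1}{\min\{\overline{\sigma}(\Delta) : \Delta \in \mathbf{\Delta},\ \det(I - M\Delta) = 0\}},$$ unless $\det(I - M\Delta) \ne 0$ for all $\Delta \in \mathbf{\Delta}$, in which case $\mu_{\mathbf{\Delta}}(M) := 0$. The convex upper bound is $$\nu_{\mathbf{\Delta}}(M) := \inf_{D \in \mathbf{D}} \overline{\sigma}(D^{1/2} M D^{-1/2}),$$ where $\mathbf{D} = \{\mathrm{diag}(d_1,\ldots,d_6) : d_j \in \mathbb{R},\ d_j > 0\}$. *)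

theory Defs
  imports "HOL-Analysis.Analysis"
begin

definition adjoint_mat :: "complex^'n^'m \<Rightarrow> complex^'m^'n" where
  "adjoint_mat A = (\<chi> i j. cnj (A $ j $ i))"

(* Square roots of the eigenvalues of A* A.  These eigenvalues are real and nonnegative, so
   letting l range over the reals loses none of them. *)
definition singular_values :: "complex^'n^'m \<Rightarrow> real set" where
  "singular_values A =
     {sqrt l | l :: real. \<exists>v. v \<noteq> 0 \<and> (adjoint_mat A ** A) *v v = complex_of_real l *s v}"

(* Singular values of a matrix form a finite nonempty set, so Max is their genuine maximum. *)
definition sigma_max :: "complex^'n^'m \<Rightarrow> real" where
  "sigma_max A = Max (singular_values A)"

definition diag_mat :: "complex^'n \<Rightarrow> complex^'n^'n" where
  "diag_mat d = (\<chi> i j. if i = j then d $ i else 0)"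

definition diag_structure :: "(complex^'n^'n) set" where
  "diag_structure = range diag_mat"

(* LEAST rather than Min, because the set of singular perturbations is infinite. *)
definition mu :: "(complex^'n^'n) set \<Rightarrow> complex^'n^'n \<Rightarrow> real" where
  "mu \<DD> M =
     (if \<forall>\<Delta>\<in>\<DD>. det (mat 1 - M ** \<Delta>) \<noteq> 0 then 0
      else 1 / (LEAST r. r \<in> sigma_max ` {\<Delta>\<in>\<DD>. det (mat 1 - M ** \<Delta>) = 0}))"

(* The upper bound belonging to diag_structure: for D = diag(d) with d > 0 entrywise,
   D^(1/2) and D^(-1/2) are the diagonal matrices of sqrt d_j and 1 / sqrt d_j. *)
definition nu_diag :: "complex^'n^'n \<Rightarrow> real" where
  "nu_diag M =
     (INF d\<in>{d :: real^'n. \<forall>j. 0 < d $ j}.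
        sigma_max (diag_mat (\<chi> j. complex_of_real (sqrt (d $ j))) ** M
                   ** diag_mat (\<chi> j. complex_of_real (1 / sqrt (d $ j)))))"

definition complex_mat :: "real^'n^'m \<Rightarrow> complex^'n^'m" where
  "complex_mat A = (\<chi> i j. complex_of_real (A $ i $ j))"

end

(* U and V have orthonormal columns, so M = U V^T is a partial isometry and sigma_max M = 1.
   Corresponding rows u_j, v_j of U and V have equal norms; summing |u_j . e|^2 and |v_j . e|^2 over
   the standard basis vectors e therefore shows that no diagonal scaling brings the norm below 1.
   If a diagonal Delta of norm 1 had M Delta x = x with x nonzero, then Delta x = V e and x = U e for
   some e in C^3, with |u_j . e| = |v_j . e| for all j. Each pair of rows (p + q)/2, (p - q)/2 of U
   forces the corresponding two entries of e to be orthogonal in C = R^2, and all three entries have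
   equal moduli; three pairwise orthogonal nonzero vectors do not exist in the plane.
   The minimum defining mu is attained (the constraint set is closed and sigma_max is proper on
   diagonal matrices), so mu = 1 would produce such a Delta. *)
theory Submission
  imports Defs
begin

section \<open>Coordinates indexed by the six-element type\<close>

lemma exhaust_6:
  fixes x :: 6
  shows "x = 1 \<or> x = 2 \<or> x = 3 \<or> x = 4 \<or> x = 5 \<or> x = 6"
proof (induct x)
  case (of_int z)
  then have "z = 0 \<or> z = 1 \<or> z = 2 \<or> z = 3 \<or> z = 4 \<or> z = 5" by fastforce
  then show ?case by auto
qed

lemma UNIV_6: "UNIV = {1, 2, 3, 4, 5, 6 :: 6}"
  using exhaust_6 by auto

lemma sum_6: "sum f (UNIV :: 6 set) = f 1 + f 2 + f 3 + f 4 + f 5 + f 6"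
  unfolding UNIV_6 by (simp add: ac_simps)

lemma forall_6: "(\<forall>i::6. P i) \<longleftrightarrow> P 1 \<and> P 2 \<and> P 3 \<and> P 4 \<and> P 5 \<and> P 6"
  by (metis exhaust_6)

lemma vector_6:
  "(vector [a, b, c, d, e, f] :: ('a::zero)^6) $ 1 = a"
  "(vector [a, b, c, d, e, f] :: ('a::zero)^6) $ 2 = b"
  "(vector [a, b, c, d, e, f] :: ('a::zero)^6) $ 3 = c"
  "(vector [a, b, c, d, e, f] :: ('a::zero)^6) $ 4 = d"
  "(vector [a, b, c, d, e, f] :: ('a::zero)^6) $ 5 = e"
  "(vector [a, b, c, d, e, f] :: ('a::zero)^6) $ 6 = f"
  unfolding vector_def by simp_all

section \<open>The largest singular value as an operator norm\<close>

lemma bounded_linear_matrix_vector_complex: "bounded_linear ((*v) (A :: complex^'n^'m))"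
proof (intro linear_conv_bounded_linear[THEN iffD1] linearI)
  show "A *v (r *\<^sub>R x) = r *\<^sub>R (A *v x)" for r x
    by (simp add: vec_eq_iff matrix_vector_mult_def scaleR_sum_right)
qed (simp add: matrix_vector_right_distrib)

text \<open>Here \<bullet> is the real inner product, the real part of the Hermitian one; the
  conjugate transpose is still the adjoint for it.\<close>

lemma adjoint_mat_inner: "(A *v x) \<bullet> y = x \<bullet> (adjoint_mat A *v y)"
  for A :: "complex^'n^'m"
proof -
  have "(A *v x) \<bullet> y = (\<Sum>i\<in>UNIV. \<Sum>j\<in>UNIV. (A $ i $ j * x $ j) \<bullet> y $ i)"
    by (simp add: inner_vec_def matrix_vector_mult_def inner_sum_left)
  also have "\<dots> = (\<Sum>i\<in>UNIV. \<Sum>j\<in>UNIV. x $ j \<bullet> (cnj (A $ i $ j) * y $ i))"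
    by (intro sum.cong refl) (simp add: inner_complex_def algebra_simps)
  also have "\<dots> = (\<Sum>j\<in>UNIV. \<Sum>i\<in>UNIV. x $ j \<bullet> (cnj (A $ i $ j) * y $ i))"
    by (rule sum.swap)
  also have "\<dots> = x \<bullet> (adjoint_mat A *v y)"
    by (simp add: inner_vec_def matrix_vector_mult_def inner_sum_right adjoint_mat_def)
  finally show ?thesis .
qed

lemma smult_complex_of_real: "complex_of_real l *s v = l *\<^sub>R v"
  by (simp add: vec_eq_iff scaleR_conv_of_real[where 'a=complex])

lemma inner_gram: "(A *v x) \<bullet> (A *v y) = x \<bullet> ((adjoint_mat A ** A) *v y)"
  for A :: "complex^'n^'m"
  by (simp add: adjoint_mat_inner matrix_vector_mul_assoc)

lemma singular_value_witness:
  fixes A :: "complex^'n^'m"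
  assumes "s \<in> singular_values A"
  obtains v where "norm v = 1" "norm (A *v v) = s" "s \<ge> 0"
    "(adjoint_mat A ** A) *v v = s\<^sup>2 *\<^sub>R v"
proof -
  obtain l v where s: "s = sqrt l" and v: "v \<noteq> 0"
    and eig: "(adjoint_mat A ** A) *v v = l *\<^sub>R v"
    using assms by (auto simp: singular_values_def smult_complex_of_real)
  interpret A: bounded_linear "(*v) A" by (rule bounded_linear_matrix_vector_complex)
  interpret G: bounded_linear "(*v) (adjoint_mat A ** A)" by (rule bounded_linear_matrix_vector_complex)
  define w where "w = v /\<^sub>R norm v"
  have w: "norm w = 1" using v by (simp add: w_def)
  have eigw: "(adjoint_mat A ** A) *v w = l *\<^sub>R w"
    by (simp add: w_def G.scaleR eig)
  \<comment> \<open>\<open>sqrt\<close> is odd on the reals, so a negative \<open>l\<close> would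
    give a negative singular value; being a squared norm, \<open>l\<close> is nonnegative.\<close>
  have "(norm (A *v w))\<^sup>2 = l"
    using w by (simp add: power2_norm_eq_inner inner_gram eigw norm_eq_1)
  then have "l \<ge> 0" "norm (A *v w) = sqrt l"
    by (auto simp: real_sqrt_unique[symmetric])
  with w eigw s show thesis by (intro that[of w]) auto
qed

text \<open>Makes \<open>Max\<close> in \<open>sigma_max\<close> meaningful. Unit eigenvectors of
  the self-adjoint Gram matrix for distinct eigenvalues are orthogonal, and a pairwise orthogonal
  set in finite dimension is finite.\<close>

lemma finite_singular_values: "finite (singular_values A)"
  for A :: "complex^'n^'m"
proof -
  define S where "S = singular_values A"
  have "\<exists>v. norm v = 1 \<and> s \<ge> 0 \<and> (adjoint_mat A ** A) *v v = s\<^sup>2 *\<^sub>R v" if "s \<in> S" for s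
    using singular_value_witness that unfolding S_def by metis
  then obtain v where v: "\<And>s. s \<in> S \<Longrightarrow> norm (v s) = 1" "\<And>s. s \<in> S \<Longrightarrow> s \<ge> 0"
    "\<And>s. s \<in> S \<Longrightarrow> (adjoint_mat A ** A) *v v s = s\<^sup>2 *\<^sub>R v s"
    by metis
  have orth: "v s \<bullet> v t = 0" if "s \<in> S" "t \<in> S" "s \<noteq> t" for s t
  proof -
    have "s\<^sup>2 * (v s \<bullet> v t) = t\<^sup>2 * (v s \<bullet> v t)"
      using inner_gram[of A "v s" "v t"] inner_gram[of A "v t" "v s"] v that
      by (simp add: inner_commute)
    moreover have "s\<^sup>2 \<noteq> t\<^sup>2"
      using that v by (simp add: power2_eq_iff_nonneg)
    ultimately show ?thesis by simp
  qed
  have inj: "inj_on v S"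
    by (rule inj_onI) (metis orth v(1) norm_eq_1 zero_neq_one)
  have "pairwise orthogonal (v ` S)"
    by (auto simp: pairwise_def orthogonal_def intro: orth)
  then have "finite (v ` S)" by (rule pairwise_orthogonal_imp_finite)
  with inj show ?thesis unfolding S_def by (simp add: finite_image_iff)
qed

text \<open>Compactness of the unit sphere gives a vector that \<open>A\<close> stretches most;
  first-order optimality makes it an eigenvector of the Gram matrix.\<close>

lemma max_singular_value:
  fixes A :: "complex^'n^'m"
  obtains s where "s \<in> singular_values A" "\<And>x. norm (A *v x) \<le> s * norm x"
proof -
  interpret A: bounded_linear "(*v) A" by (rule bounded_linear_matrix_vector_complex)
  have "compact (sphere (0 :: complex^'n) 1)" by simp
  moreover have "sphere (0 :: complex^'n) 1 \<noteq> {}" by simp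
  moreover have "continuous_on (sphere 0 1) (\<lambda>x. norm (A *v x))"
    by (intro continuous_intros A.continuous_on)
  ultimately obtain v where v: "norm v = 1" and max: "\<And>x. norm x = 1 \<Longrightarrow> norm (A *v x) \<le> norm (A *v v)"
    using continuous_attains_sup[of "sphere (0 :: complex^'n) 1" "\<lambda>x. norm (A *v x)"]
    by auto
  define s where "s = norm (A *v v)"
  have bound: "norm (A *v x) \<le> s * norm x" for x
  proof (cases "x = 0")
    case False
    then have "norm (A *v (x /\<^sub>R norm x)) \<le> s" unfolding s_def by (intro max) simp
    with False show ?thesis by (simp add: A.scaleR field_simps)
  qed simp
  \<comment> \<open>The nonnegative quadratic form \<open>s\<^sup>2 |x|\<^sup>2 - |A x|\<^sup>2\<close> vanishes at \<open>v\<close>, so its gradient \<open>2 w\<close> there vanishes too.\<close>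
  define w where "w = s\<^sup>2 *\<^sub>R v - (adjoint_mat A ** A) *v v"
  define q where "q t = s\<^sup>2 * (norm (v + t *\<^sub>R w))\<^sup>2 - (norm (A *v (v + t *\<^sub>R w)))\<^sup>2" for t
  have q: "q t = 2 * (w \<bullet> w) * t + (s\<^sup>2 * (w \<bullet> w) - (A *v w) \<bullet> (A *v w)) * t\<^sup>2" for t
  proof -
    have "q t = (s\<^sup>2 * (v \<bullet> v) - (A *v v) \<bullet> (A *v v)) + 2 * (s\<^sup>2 * (w \<bullet> v) - (A *v w) \<bullet> (A *v v)) * t
      + (s\<^sup>2 * (w \<bullet> w) - (A *v w) \<bullet> (A *v w)) * t\<^sup>2"
      unfolding q_def power2_norm_eq_inner
      by (simp add: A.add A.scaleR inner_add_left inner_add_right inner_commute[of v w]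
          inner_commute[of "A *v v" "A *v w"] power2_eq_square algebra_simps)
    moreover have "s\<^sup>2 * (w \<bullet> v) - (A *v w) \<bullet> (A *v v) = w \<bullet> w"
      unfolding inner_gram by (simp add: w_def inner_diff_right)
    moreover have "s\<^sup>2 * (v \<bullet> v) = (A *v v) \<bullet> (A *v v)"
      using v by (simp add: s_def power2_norm_eq_inner norm_eq_1)
    ultimately show ?thesis by simp
  qed
  have "q t \<ge> 0" for t
    using power_mono[OF bound[of "v + t *\<^sub>R w"], of 2] by (simp add: q_def power_mult_distrib)
  moreover have "(q has_real_derivative 2 * (w \<bullet> w)) (at 0)"
    unfolding q[abs_def] by (auto intro!: derivative_eq_intros)
  ultimately have "2 * (w \<bullet> w) = 0"
    by (intro DERIV_local_min[of q _ 0 1]) (auto simp: q[of 0])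
  then have "(adjoint_mat A ** A) *v v = s\<^sup>2 *\<^sub>R v"
    by (simp add: w_def)
  then have "s \<in> singular_values A"
    using v unfolding singular_values_def smult_complex_of_real
    by (auto simp: s_def intro!: exI[of _ "s\<^sup>2"] exI[of _ v])
  with bound show thesis by (rule that[rotated])
qed

text \<open>Unit singular vectors bound each singular value by the operator norm, and
  \<open>max_singular_value\<close> shows that the bound is attained.\<close>

proposition sigma_max_eq_onorm: "sigma_max A = onorm ((*v) A)"
  for A :: "complex^'n^'m"
proof -
  interpret A: bounded_linear "(*v) A" by (rule bounded_linear_matrix_vector_complex)
  obtain s where s: "s \<in> singular_values A" and bound: "\<And>x. norm (A *v x) \<le> s * norm x"
    using max_singular_value by blast
  have le: "t \<le> onorm ((*v) A)" if "t \<in> singular_values A" for t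
    using singular_value_witness[OF that] onorm[OF A.bounded_linear_axioms] by (metis mult.right_neutral)
  with s have "s \<le> onorm ((*v) A)" by blast
  moreover have "onorm ((*v) A) \<le> s"
    by (rule onorm_le) (rule bound)
  ultimately have "onorm ((*v) A) = s" by simp
  then show ?thesis
    unfolding sigma_max_def using s le by (intro Max_eqI finite_singular_values) auto
qed

section \<open>Singular diagonal perturbations and attainment of the minimum in
  \<open>mu\<close>\<close>

lemma det_one_minus_eq_0:
  fixes M :: "complex^'n^'n"
  assumes "det (mat 1 - M ** D) = 0"
  obtains x where "x \<noteq> 0" "M *v (D *v x) = x"
proof -
  have "\<not> invertible (mat 1 - M ** D)" using assms by (simp add: invertible_det_nz)
  then obtain x where "x \<noteq> 0" "(mat 1 - M ** D) *v x = 0"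
    unfolding invertible_left_inverse matrix_left_invertible_ker by blast
  then show thesis
    by (intro that[of x]) (auto simp: matrix_vector_mult_diff_rdistrib matrix_vector_mul_assoc)
qed

lemma diag_mat_mult_vec: "(diag_mat d *v x) $ i = d $ i * x $ i"
  by (simp add: diag_mat_def matrix_vector_mult_def if_distrib[of "\<lambda>a. a * _"] cong: if_cong)

lemma diag_mat_1: "diag_mat (\<chi> j. 1) = (mat 1 :: complex^'n^'n)"
  by (simp add: vec_eq_iff diag_mat_def mat_def)

lemma norm_diag_mat_mult_le: "norm (diag_mat d *v x) \<le> norm d * norm x"
proof -
  have "norm (diag_mat d *v x) \<le> norm (norm d *\<^sub>R x)"
    by (rule norm_le_componentwise_cart)
      (simp add: diag_mat_mult_vec norm_mult mult_right_mono Finite_Cartesian_Product.norm_nth_le)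
  then show ?thesis by simp
qed

text \<open>Supplies the continuity for the compactness argument in
  \<open>mu_diag_structure_cases\<close>.\<close>

lemma sigma_max_diag_lipschitz: "\<bar>sigma_max (diag_mat d) - sigma_max (diag_mat e)\<bar> \<le> norm (d - e)"
  for d e :: "complex^'n"
proof -
  have le: "onorm ((*v) (diag_mat d)) \<le> norm (d - e) + onorm ((*v) (diag_mat e))" for d e :: "complex^'n"
  proof (rule onorm_le)
    fix x
    have "norm (diag_mat (d - e) *v x) \<le> norm (d - e) * norm x"
      by (rule norm_diag_mat_mult_le)
    moreover have "norm (diag_mat e *v x) \<le> onorm ((*v) (diag_mat e)) * norm x"
      by (rule onorm[OF bounded_linear_matrix_vector_complex])
    moreover have "diag_mat d *v x = diag_mat (d - e) *v x + diag_mat e *v x"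
      by (simp add: vec_eq_iff diag_mat_mult_vec algebra_simps)
    ultimately show "norm (diag_mat d *v x) \<le> (norm (d - e) + onorm ((*v) (diag_mat e))) * norm x"
      using norm_triangle_ineq[of "diag_mat (d - e) *v x" "diag_mat e *v x"] by (simp add: algebra_simps)
  qed
  show ?thesis
    using le[of d e] le[of e d] by (simp add: sigma_max_eq_onorm norm_minus_commute)
qed

text \<open>\<open>LEAST\<close> on the reals says nothing unless a minimum exists, so a minimizing
  perturbation has to be produced before \<open>mu\<close> can be evaluated.\<close>

lemma mu_diag_structure_cases:
  fixes M :: "complex^'n^'n"
  obtains "mu diag_structure M = 0"
  | d where "det (mat 1 - M ** diag_mat d) = 0" "mu diag_structure M = 1 / sigma_max (diag_mat d)"
proof (cases "\<forall>d. det (mat 1 - M ** diag_mat d) \<noteq> 0")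
  case True
  then show thesis by (intro that(1)) (simp add: mu_def diag_structure_def)
next
  case False
  define Z where "Z = {d. det (mat 1 - M ** diag_mat d) = 0}"
  define f where "f d = sigma_max (diag_mat d)" for d :: "complex^'n"
  obtain e where e: "e \<in> Z" using False by (auto simp: Z_def)
  \<comment> \<open>The determinant is a polynomial in the entries of \<open>d\<close>, hence
    continuous.\<close>
  have "closed Z"
    unfolding Z_def det_def
    by (intro closed_Collect_eq continuous_intros)
      (auto simp: diag_mat_def matrix_matrix_mult_def mat_def if_distrib intro!: continuous_intros cong: if_cong)
  have "1-lipschitz_on UNIV f"
    by (rule lipschitz_onI) (simp_all add: f_def dist_real_def dist_norm sigma_max_diag_lipschitz)
  then have f: "continuous_on UNIV f" by (rule lipschitz_on_continuous_on)
  \<comment> \<open>\<open>diag_mat d\<close> sends the all-ones vector \<open>1\<close> to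
    \<open>d\<close>, so sublevel sets of \<open>f\<close> are bounded.\<close>
  have "norm d \<le> f e * norm (1 :: complex^'n)" if "f d \<le> f e" for d
  proof -
    have "diag_mat d *v 1 = d" by (simp add: vec_eq_iff diag_mat_mult_vec)
    then have "norm d \<le> f d * norm (1 :: complex^'n)"
      using onorm[OF bounded_linear_matrix_vector_complex, of "diag_mat d" 1]
      by (simp add: f_def sigma_max_eq_onorm)
    also have "\<dots> \<le> f e * norm (1 :: complex^'n)"
      using that by (rule mult_right_mono) simp
    finally show ?thesis .
  qed
  then have "bounded {d. f d \<le> f e}" unfolding bounded_iff by blast
  moreover have "closed {d. f d \<le> f e}"
    by (intro closed_Collect_le f continuous_on_const)
  ultimately have "compact (Z \<inter> {d. f d \<le> f e})"
    using \<open>closed Z\<close> by (intro closed_Int_compact) (simp_all add: compact_eq_bounded_closed)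
  then obtain d where d: "d \<in> Z" "f d \<le> f e" and le: "\<And>d'. d' \<in> Z \<Longrightarrow> f d' \<le> f e \<Longrightarrow> f d \<le> f d'"
    using continuous_attains_inf[of "Z \<inter> {d. f d \<le> f e}" f] e continuous_on_subset[OF f] by auto
  \<comment> \<open>Points of \<open>Z\<close> outside the sublevel set have values above
    \<open>f e\<close>, hence above \<open>f d\<close>: the minimum is global.\<close>
  have "(LEAST r. r \<in> f ` Z) = f d"
    using d le by (intro Least_equality) (auto, metis linear order_trans)
  moreover have "sigma_max ` {\<Delta> \<in> diag_structure. det (mat 1 - M ** \<Delta>) = 0} = f ` Z"
    by (auto simp: f_def Z_def diag_structure_def)
  ultimately have "mu diag_structure M = 1 / f d"
    using False by (auto simp: mu_def diag_structure_def)
  with d show thesis by (intro that(2)) (auto simp: Z_def f_def)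
qed

section \<open>The concrete matrix: its norm, its scalings, its singular perturbations\<close>

lemma UVT_mult_vec:
  fixes U V :: "real^3^6" and y :: "complex^6"
  assumes U: "U = (1/2) *\<^sub>R vector
      [vector [1,  1,  0],
       vector [1, -1,  0],
       vector [1,  0,  1],
       vector [1,  0, -1],
       vector [0,  1,  1],
       vector [0,  1, -1]]"
    and V: "V = (1 / sqrt 2) *\<^sub>R vector
      [vector [0, 0, 1],
       vector [0, 0, 1],
       vector [0, 1, 0],
       vector [0, 1, 0],
       vector [1, 0, 0],
       vector [1, 0, 0]]"
  shows "complex_mat (U ** transpose V) *v y
    = (1 / (2 * sqrt 2)) *\<^sub>R vector [(y$5 + y$6) + (y$3 + y$4), (y$5 + y$6) - (y$3 + y$4),
      (y$5 + y$6) + (y$1 + y$2), (y$5 + y$6) - (y$1 + y$2),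
      (y$3 + y$4) + (y$1 + y$2), (y$3 + y$4) - (y$1 + y$2)]"
  unfolding vec_eq_iff forall_6
  by (simp add: U V complex_mat_def matrix_matrix_mult_def matrix_vector_mult_def transpose_def
      sum_3 sum_6 vector_6 field_simps scaleR_conv_of_real[where 'a=complex])

lemma norm_sq_6: "(norm x)\<^sup>2 = (norm (x$1))\<^sup>2 + (norm (x$2))\<^sup>2 + (norm (x$3))\<^sup>2
    + (norm (x$4))\<^sup>2 + (norm (x$5))\<^sup>2 + (norm (x$6))\<^sup>2"
  for x :: "complex^6"
  by (simp add: norm_vec_def L2_set_def sum_6 add_nonneg_nonneg)

text \<open>The complex numbers have real dimension 2, and nonzero pairwise orthogonal vectors are
  independent.\<close>

lemma complex_pairwise_orthogonal_eq_0:
  fixes a b c :: complex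
  assumes "a \<bullet> b = 0" "a \<bullet> c = 0" "b \<bullet> c = 0"
  shows "a = 0 \<or> b = 0 \<or> c = 0"
proof (rule ccontr)
  assume nz: "\<not> ?thesis"
  define S where "S = {a, b, c}"
  have ne: "a \<noteq> b" "a \<noteq> c" "b \<noteq> c" using assms nz by auto
  have "pairwise orthogonal S"
    using assms by (auto simp: S_def pairwise_def orthogonal_def inner_commute)
  moreover have "0 \<notin> S" using nz by (auto simp: S_def)
  ultimately have "independent S" by (rule pairwise_orthogonal_independent)
  then have "card S \<le> DIM(complex)" using independent_bound by blast
  then show False using ne by (simp add: S_def)
qed

text \<open>Only the action on vectors and the square of the scalar matter, which keeps
  \<open>sqrt 2\<close> out of the computations.\<close>

locale partial_isometry_6 =
  fixes C :: "complex^6^6" and h :: real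
  assumes h: "h\<^sup>2 = 1 / 8"
    and C: "C *v y = h *\<^sub>R vector [(y$5 + y$6) + (y$3 + y$4), (y$5 + y$6) - (y$3 + y$4),
      (y$5 + y$6) + (y$1 + y$2), (y$5 + y$6) - (y$1 + y$2),
      (y$3 + y$4) + (y$1 + y$2), (y$3 + y$4) - (y$1 + y$2)]"
begin

lemma C_nth:
  "(C *v y) $ 1 = h *\<^sub>R ((y$5 + y$6) + (y$3 + y$4))"
  "(C *v y) $ 2 = h *\<^sub>R ((y$5 + y$6) - (y$3 + y$4))"
  "(C *v y) $ 3 = h *\<^sub>R ((y$5 + y$6) + (y$1 + y$2))"
  "(C *v y) $ 4 = h *\<^sub>R ((y$5 + y$6) - (y$1 + y$2))"
  "(C *v y) $ 5 = h *\<^sub>R ((y$3 + y$4) + (y$1 + y$2))"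
  "(C *v y) $ 6 = h *\<^sub>R ((y$3 + y$4) - (y$1 + y$2))"
  by (simp_all only: C vector_6 vector_scaleR_component)

text \<open>By the parallelogram law, first for pairs of rows of \<open>U\<close>, then for pairs of
  entries of \<open>y\<close>. The deficit measures the distance from the range of
  \<open>V\<close>.\<close>

lemma norm_C: "(norm (C *v y))\<^sup>2 = (norm y)\<^sup>2
    - ((norm (y$1 - y$2))\<^sup>2 + (norm (y$3 - y$4))\<^sup>2 + (norm (y$5 - y$6))\<^sup>2) / 2"
proof -
  have eq: "(norm (C *v y))\<^sup>2 = ((norm ((y$5 + y$6) + (y$3 + y$4)))\<^sup>2 + (norm ((y$5 + y$6) - (y$3 + y$4)))\<^sup>2
      + (norm ((y$5 + y$6) + (y$1 + y$2)))\<^sup>2 + (norm ((y$5 + y$6) - (y$1 + y$2)))\<^sup>2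
      + (norm ((y$3 + y$4) + (y$1 + y$2)))\<^sup>2 + (norm ((y$3 + y$4) - (y$1 + y$2)))\<^sup>2) / 8"
    by (simp add: norm_sq_6 C_nth power_mult_distrib h)
  show ?thesis
    unfolding eq norm_sq_6[of y] unfolding power2_norm_eq_inner
    by (simp add: inner_add_left inner_add_right inner_diff_left inner_diff_right inner_commute field_simps)
qed

lemma sigma_max_le_1: "sigma_max C \<le> 1"
proof -
  have "norm (C *v y) \<le> norm y" for y
    by (rule power2_le_imp_le) (simp_all add: norm_C)
  then show ?thesis
    unfolding sigma_max_eq_onorm by (intro onorm_le) simp
qed

lemma sigma_max_scaled_ge_1:
  fixes d :: "real^6"
  assumes d: "\<And>j. 0 < d $ j"
  shows "1 \<le> sigma_max (diag_mat (\<chi> j. complex_of_real (sqrt (d $ j))) ** C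
      ** diag_mat (\<chi> j. complex_of_real (1 / sqrt (d $ j))))"
    (is "1 \<le> sigma_max ?N")
proof -
  define r where "r x = (\<chi> j. complex_of_real (sqrt (d $ j)) * x $ j)" for x :: "complex^6"
  have d0: "d $ j \<ge> 0" "d $ j \<noteq> 0" for j using d[of j] by auto
  \<comment> \<open>Applying the scaled matrix to \<open>r x\<close> cancels the inverse root,
    leaving an inequality for \<open>C\<close> in the norm with weights
    \<open>d $ j\<close>.\<close>
  have bound: "(norm (r (C *v x)))\<^sup>2 \<le> (sigma_max ?N)\<^sup>2 * (norm (r x))\<^sup>2" for x
  proof -
    have "diag_mat (\<chi> j. complex_of_real (1 / sqrt (d $ j))) *v r x = x"
      using d0 by (simp add: vec_eq_iff diag_mat_mult_vec r_def)
    then have "?N *v r x = r (C *v x)"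
      by (simp add: matrix_vector_mul_assoc[symmetric] del: of_real_divide)
        (simp add: vec_eq_iff diag_mat_mult_vec r_def)
    then have "norm (r (C *v x)) \<le> sigma_max ?N * norm (r x)"
      using onorm[OF bounded_linear_matrix_vector_complex, of ?N "r x"] by (simp add: sigma_max_eq_onorm)
    then show ?thesis
      using power_mono[of _ _ 2] by (fastforce simp: power_mult_distrib)
  qed
  define D where "D = d$1 + d$2 + d$3 + d$4 + d$5 + d$6"
  have "D > 0" unfolding D_def by (intro add_pos_pos d)
  \<comment> \<open>Summed over the three columns of \<open>V\<close>, the weights on both sides agree because each row of \<open>U\<close>
    has the same norm as the corresponding row of \<open>V\<close>.\<close>
  have "1 * D \<le> (sigma_max ?N)\<^sup>2 * D"
    using bound[of "vector [0,0,0,0,1,1]"] bound[of "vector [0,0,1,1,0,0]"] bound[of "vector [1,1,0,0,0,0]"]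
    by (simp add: norm_sq_6 r_def C_nth vector_6 norm_mult power_mult_distrib h d0 D_def algebra_simps)
  then have "1 \<le> (sigma_max ?N)\<^sup>2" using \<open>D > 0\<close> by simp
  moreover have "sigma_max ?N \<ge> 0"
    unfolding sigma_max_eq_onorm by (rule onorm_pos_le[OF bounded_linear_matrix_vector_complex])
  ultimately show ?thesis using power2_le_imp_le[of 1 "sigma_max ?N"] by simp
qed

lemma sigma_max_eq_1: "sigma_max C = 1"
  using sigma_max_scaled_ge_1[of "\<chi> j. 1"] sigma_max_le_1 by (simp add: diag_mat_1)

lemma nu_eq_1: "nu_diag C = 1"
  unfolding nu_diag_def
proof (rule cInf_eq_minimum)
  show "1 \<in> (\<lambda>d. sigma_max (diag_mat (\<chi> j. complex_of_real (sqrt (d $ j))) ** C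
      ** diag_mat (\<chi> j. complex_of_real (1 / sqrt (d $ j))))) ` {d :: real^6. \<forall>j. 0 < d $ j}"
    by (rule image_eqI[of _ _ "\<chi> j. 1"]) (simp_all add: diag_mat_1 sigma_max_eq_1)
qed (use sigma_max_scaled_ge_1 in blast)

lemma sigma_max_singular_diag_neq_1:
  assumes det0: "det (mat 1 - C ** diag_mat d) = 0"
  shows "sigma_max (diag_mat d) \<noteq> 1"
proof
  assume d1: "sigma_max (diag_mat d) = 1"
  obtain x where "x \<noteq> 0" and x: "C *v (diag_mat d *v x) = x"
    using det_one_minus_eq_0[OF det0] by blast
  define y where "y = diag_mat d *v x"
  have "norm y \<le> norm x"
    using onorm[OF bounded_linear_matrix_vector_complex, of "diag_mat d" x] d1
    by (simp add: sigma_max_eq_onorm y_def)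
  \<comment> \<open>The deficit in \<open>norm_C\<close> must vanish, which forces the entries of
    \<open>y\<close> to agree in pairs.\<close>
  then have "(norm y)\<^sup>2 \<le> (norm (C *v y))\<^sup>2" by (simp add: x y_def)
  then have "(norm (y$1 - y$2))\<^sup>2 + (norm (y$3 - y$4))\<^sup>2 + (norm (y$5 - y$6))\<^sup>2 \<le> 0"
    unfolding norm_C by simp
  then have "(norm (y$1 - y$2))\<^sup>2 = 0 \<and> (norm (y$3 - y$4))\<^sup>2 = 0 \<and> (norm (y$5 - y$6))\<^sup>2 = 0"
    using zero_le_power2[of "norm (y$1 - y$2)"] zero_le_power2[of "norm (y$3 - y$4)"]
      zero_le_power2[of "norm (y$5 - y$6)"] by linarith
  then have y_eq: "y$2 = y$1" "y$4 = y$3" "y$6 = y$5" by auto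
  have "norm (d $ j) \<le> 1" for j
  proof -
    have "diag_mat d *v axis j 1 = axis j (d $ j)"
      by (auto simp: vec_eq_iff diag_mat_mult_vec axis_def)
    then show ?thesis
      using onorm[OF bounded_linear_matrix_vector_complex, of "diag_mat d" "axis j 1"] d1
        Finite_Cartesian_Product.norm_nth_le[of "axis j (d $ j)" j]
      by (simp add: sigma_max_eq_onorm)
  qed
  \<comment> \<open>Since \<open>C *v y = x\<close>, entry \<open>j\<close> of \<open>y\<close> is
    \<open>d $ j\<close> times that of \<open>C *v y\<close>.\<close>
  then have "norm (y $ j) \<le> norm ((C *v y) $ j)" for j
    by (simp add: x y_def diag_mat_mult_vec norm_mult mult_left_le_one_le)
  then have ineq: "(norm (y $ j))\<^sup>2 \<le> (norm ((C *v y) $ j))\<^sup>2" for j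
    by (intro power_mono) auto
  define a b c where "a = y$5" and "b = y$3" and "c = y$1"
  have plus: "(norm (h *\<^sub>R ((p + p) + (q + q))))\<^sup>2 = (p \<bullet> p + q \<bullet> q) / 2 + p \<bullet> q"
    and minus: "(norm (h *\<^sub>R ((p + p) - (q + q))))\<^sup>2 = (p \<bullet> p + q \<bullet> q) / 2 - p \<bullet> q" for p q :: complex
    unfolding norm_scaleR power_mult_distrib power2_abs h power2_norm_eq_inner
      inner_add_left inner_add_right inner_diff_left inner_diff_right
    by (simp_all add: inner_commute)
  have pairs: "c \<bullet> c \<le> (a \<bullet> a + b \<bullet> b) / 2 + a \<bullet> b" "c \<bullet> c \<le> (a \<bullet> a + b \<bullet> b) / 2 - a \<bullet> b"
    "b \<bullet> b \<le> (a \<bullet> a + c \<bullet> c) / 2 + a \<bullet> c" "b \<bullet> b \<le> (a \<bullet> a + c \<bullet> c) / 2 - a \<bullet> c"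
    "a \<bullet> a \<le> (b \<bullet> b + c \<bullet> c) / 2 + b \<bullet> c" "a \<bullet> a \<le> (b \<bullet> b + c \<bullet> c) / 2 - b \<bullet> c"
    using ineq[of 1] ineq[of 2] ineq[of 3] ineq[of 4] ineq[of 5] ineq[of 6]
    unfolding C_nth y_eq plus minus unfolding power2_norm_eq_inner a_def b_def c_def .
  \<comment> \<open>Adding suitable choices of three of these inequalities cancels all squared norms.\<close>
  have "a \<bullet> b = 0" "a \<bullet> c = 0" "b \<bullet> c = 0"
    using pairs by argo+
  then have "a = 0 \<or> b = 0 \<or> c = 0" by (rule complex_pairwise_orthogonal_eq_0)
  \<comment> \<open>Averaging the two inequalities on each line removes the mixed term: each squared
    norm is at most the mean of the other two, so all three agree.\<close>
  moreover have "a \<bullet> a = b \<bullet> b" "b \<bullet> b = c \<bullet> c" using pairs by argo+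
  ultimately have "a = 0" "b = 0" "c = 0" by auto
  then have "y = 0" by (simp add: vec_eq_iff forall_6 y_eq a_def b_def c_def)
  then show False using x \<open>x \<noteq> 0\<close> by (simp add: y_def)
qed

end

theorem mainTheorem2:
  fixes U V :: "real^3^6" and M :: "real^6^6"
  assumes U: "U = (1/2) *\<^sub>R vector
      [vector [1,  1,  0],
       vector [1, -1,  0],
       vector [1,  0,  1],
       vector [1,  0, -1],
       vector [0,  1,  1],
       vector [0,  1, -1]]"
    and V: "V = (1 / sqrt 2) *\<^sub>R vector
      [vector [0, 0, 1],
       vector [0, 0, 1],
       vector [0, 1, 0],
       vector [0, 1, 0],
       vector [1, 0, 0],
       vector [1, 0, 0]]"
    and M: "M = U ** transpose V"
  shows "nu_diag (complex_mat M) = sigma_max (complex_mat M)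
    \<and> sigma_max (complex_mat M) = 1
    \<and> mu diag_structure (complex_mat M) \<noteq> nu_diag (complex_mat M)"
proof -
  interpret partial_isometry_6 "complex_mat M" "1 / (2 * sqrt 2)"
  proof
    show "(1 / (2 * sqrt 2))\<^sup>2 = (1 / 8 :: real)" by (simp add: power_divide power_mult_distrib)
  qed (simp only: M UVT_mult_vec[OF U V])
  \<comment> \<open>If \<open>mu\<close> were 1, the minimizing perturbation would have norm 1,
    which \<open>sigma_max_singular_diag_neq_1\<close> excludes.\<close>
  have "mu diag_structure (complex_mat M) \<noteq> 1"
  proof (cases rule: mu_diag_structure_cases[of "complex_mat M"])
    case (2 d)
    with sigma_max_singular_diag_neq_1[OF 2(1)] show ?thesis
      by (auto simp: divide_eq_1_iff)
  qed simp
  then show ?thesis by (simp add: nu_eq_1 sigma_max_eq_1)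
qed

end
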